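(* Let $\Omega=\{1,\ldots,n\}$. The set $\mathrm{Com}(\mathfrak{S}_n)$ of linear maps $h:\mathcal{S}_n\to\mathcal{S}_n$ satisfying $h\circ\sigma=\sigma\circ h$ for all $\sigma\in\mathfrak{S}_n$ is generated, as a real algebra under composition of mappings, by derivation $\partial$ and complementation $\complement$.
   Context: $\mathcal{S}_n$ is the quotient of $\mathbb{R}[x_1,\ldots,x_n]$ by the ideal generated by $x_1^2-x_1,\ldots,x_n^2-x_n$; it is a real vector space with basis $p_A=\prod_{i\in A}x_i$, $A\subseteq\Omega$. The symmetric group $\mathfrak{S}_n$ acts on $\mathcal{S}_n$ by algebra automorphisms with $\sigma\cdot x_i=x_{\sigma(i)}$, i.e. $\sigma\cdot p_A=p_{\sigma(A)}$. Derivation $\partial$ and complementation $\complement$ are the linear maps $\mathcal{S}_n\to\mathcal{S}_n$ defined by $\partial(p_A)=\sum_{i\in A}p_{A\setminus\{i\}}$ and $\complement(p_A)=p_{\Omega\setminus A}$ for all $A\subseteq\Omega$. *)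

theory Defs
  imports Complex_Main "HOL-Library.Poly_Mapping" "HOL-Combinatorics.Permutations"
begin

text \<open>
  A monomial over the index type \<open>'n\<close> is its finitely supported exponent function, a polynomial
  is the finitely supported function of its coefficients.
\<close>

type_synonym 'n mpoly = "('n \<Rightarrow>\<^sub>0 nat) \<Rightarrow>\<^sub>0 real"

definition var :: "'n \<Rightarrow> 'n mpoly" where
  "var i = Poly_Mapping.single (Poly_Mapping.single i 1) 1"

definition subst :: "(real \<Rightarrow> 'b) \<Rightarrow> ('n \<Rightarrow> 'b) \<Rightarrow> 'n mpoly \<Rightarrow> 'b::comm_ring_1" where
  "subst \<phi> f p = (\<Sum>m\<in>Poly_Mapping.keys p.
      \<phi> (Poly_Mapping.lookup p m) * (\<Prod>i\<in>Poly_Mapping.keys m. f i ^ Poly_Mapping.lookup m i))"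

locale real_hom =
  fixes \<phi> :: "real \<Rightarrow> 'b::comm_ring_1"
  assumes hom_add: "\<phi> (a + b) = \<phi> a + \<phi> b"
    and hom_mult: "\<phi> (a * b) = \<phi> a * \<phi> b"
    and hom_one: "\<phi> 1 = 1"
begin

lemma hom_zero: "\<phi> 0 = 0"
  using hom_add[of 0 0] by simp

lemma subst_zero: "subst \<phi> f 0 = 0"
  by (simp add: subst_def)

lemma subst_add: "subst \<phi> f (p + q) = subst \<phi> f p + subst \<phi> f q"
  unfolding subst_def
  by (rule setsum_keys_plus_distrib) (auto simp: hom_zero hom_add algebra_simps)

lemma subst_uminus: "subst \<phi> f (- p) = - subst \<phi> f p"
  using subst_add[of f p "- p"] by (simp add: subst_zero eq_neg_iff_add_eq_0 add.commute)

lemma subst_diff: "subst \<phi> f (p - q) = subst \<phi> f p - subst \<phi> f q"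
  using subst_add[of f p "- q"] by (simp add: subst_uminus)

lemma subst_sum: "subst \<phi> f (sum g A) = (\<Sum>a\<in>A. subst \<phi> f (g a))"
  by (induction A rule: infinite_finite_induct) (simp_all add: subst_zero subst_add)

lemma subst_single:
  "subst \<phi> f (Poly_Mapping.single m c) = \<phi> c * (\<Prod>i\<in>Poly_Mapping.keys m. f i ^ Poly_Mapping.lookup m i)"
  by (cases "c = 0") (simp_all add: subst_def hom_zero)

end

lemma monom_eval_add:
  fixes f :: "'n \<Rightarrow> 'b::comm_ring_1"
  shows "(\<Prod>i\<in>Poly_Mapping.keys (m + k). f i ^ Poly_Mapping.lookup (m + k) i) =
    (\<Prod>i\<in>Poly_Mapping.keys m. f i ^ Poly_Mapping.lookup m i) *
    (\<Prod>i\<in>Poly_Mapping.keys k. f i ^ Poly_Mapping.lookup k i)"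
proof -
  let ?A = "Poly_Mapping.keys m \<union> Poly_Mapping.keys k"
  have ext: "(\<Prod>i\<in>Poly_Mapping.keys l. f i ^ Poly_Mapping.lookup l i) =
      (\<Prod>i\<in>?A. f i ^ Poly_Mapping.lookup l i)" if "Poly_Mapping.keys l \<subseteq> ?A" for l
    using that by (intro prod.mono_neutral_left) (auto simp: in_keys_iff)
  show ?thesis
    by (subst (1 2 3) ext)
      (use keys_add[of m k] in \<open>auto simp: lookup_add power_add prod.distrib\<close>)
qed

lemma mpoly_as_sum:
  fixes p :: "'n mpoly"
  shows "p = (\<Sum>m\<in>Poly_Mapping.keys p. Poly_Mapping.single m (Poly_Mapping.lookup p m))"
proof (rule poly_mapping_eqI)
  fix k
  have "(\<Sum>m\<in>Poly_Mapping.keys p. Poly_Mapping.lookup (Poly_Mapping.single m (Poly_Mapping.lookup p m)) k)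
      = (\<Sum>m\<in>Poly_Mapping.keys p. if m = k then Poly_Mapping.lookup p m else 0)"
    by (intro sum.cong) (auto simp: lookup_single when_def)
  then show "Poly_Mapping.lookup p k = Poly_Mapping.lookup
      (\<Sum>m\<in>Poly_Mapping.keys p. Poly_Mapping.single m (Poly_Mapping.lookup p m)) k"
    by (simp add: lookup_sum in_keys_iff)
qed

lemma mpoly_induct [case_names zero add single]:
  fixes p :: "'n mpoly"
  assumes "P 0" "\<And>p q. P p \<Longrightarrow> P q \<Longrightarrow> P (p + q)" "\<And>m c. P (Poly_Mapping.single m c)"
  shows "P p"
proof -
  have "P (\<Sum>m\<in>A. Poly_Mapping.single m (Poly_Mapping.lookup p m))" for A
    by (induction A rule: infinite_finite_induct) (use assms in auto)
  then show ?thesis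
    using mpoly_as_sum[of p] by metis
qed

context real_hom
begin

lemma subst_mult: "subst \<phi> f (p * q) = subst \<phi> f p * subst \<phi> f q"
proof (induction p rule: mpoly_induct)
  case (single m c)
  show ?case
    by (induction q rule: mpoly_induct)
      (simp_all add: subst_zero subst_add distrib_left mult_single subst_single monom_eval_add
        hom_mult mult.assoc mult.left_commute)
qed (simp_all add: subst_zero subst_add distrib_right)

lemma subst_one: "subst \<phi> f 1 = 1"
  using subst_single[of f 0 1] by (simp add: hom_one)

lemma subst_var: "subst \<phi> f (var i) = f i"
  by (simp add: var_def subst_single hom_one)

end

lemma real_hom_single: "real_hom (Poly_Mapping.single 0 :: real \<Rightarrow> 'n mpoly)"
  by standard (simp_all add: single_add mult_single)

lemma real_hom_id: "real_hom (\<lambda>x. x)"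
  by standard simp_all

text \<open>
  The ideal generated by \<open>G\<close> is the submodule spanned by \<open>G\<close> in the ring viewed as a module
  over itself.
\<close>

definition ideal_generated :: "'a::comm_ring_1 set \<Rightarrow> 'a set" where
  "ideal_generated G = module.span (*) G"

lemma module_times: "module ((*) :: 'a::comm_ring_1 \<Rightarrow> 'a \<Rightarrow> 'a)"
  by standard (simp_all add: algebra_simps)

definition idem_ideal :: "'n mpoly set" where
  "idem_ideal = ideal_generated (range (\<lambda>i. (var i)^2 - var i))"

lemma idem_ideal_zero: "0 \<in> idem_ideal"
  and idem_ideal_add: "p \<in> idem_ideal \<Longrightarrow> q \<in> idem_ideal \<Longrightarrow> p + q \<in> idem_ideal"
  and idem_ideal_uminus: "p \<in> idem_ideal \<Longrightarrow> - p \<in> idem_ideal"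
  and idem_ideal_mult: "p \<in> idem_ideal \<Longrightarrow> r * p \<in> idem_ideal"
  and idem_ideal_gen: "(var i)^2 - var i \<in> idem_ideal"
  unfolding idem_ideal_def ideal_generated_def
  by (auto intro: module.span_zero[OF module_times] module.span_add[OF module_times]
      module.span_neg[OF module_times] module.span_scale[OF module_times]
      module.span_base[OF module_times])

lemma (in real_hom) subst_in_ideal:
  assumes p: "p \<in> idem_ideal"
    and S: "0 \<in> S" "\<And>a b. a \<in> S \<Longrightarrow> b \<in> S \<Longrightarrow> a + b \<in> S" "\<And>a r. a \<in> S \<Longrightarrow> r * a \<in> S"
    and f: "\<And>i. (f i)^2 - f i \<in> S"
  shows "subst \<phi> f p \<in> S"
  using p unfolding idem_ideal_def ideal_generated_def
proof (induction rule: module.span_induct_alt[OF module_times, consumes 1, case_names base step])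
  case base
  then show ?case by (simp add: subst_zero S)
next
  case (step c x y)
  from step(1) obtain i where "x = (var i)^2 - var i" by auto
  then have "subst \<phi> f x = (f i)^2 - f i"
    by (simp add: subst_diff subst_mult subst_var power2_eq_square)
  then show ?case
    using step f[of i] by (simp add: subst_add subst_mult S)
qed

definition idem_rel :: "'n mpoly \<Rightarrow> 'n mpoly \<Rightarrow> bool" where
  "idem_rel p q \<longleftrightarrow> p - q \<in> idem_ideal"

lemma equivp_idem_rel: "equivp (idem_rel :: 'n mpoly \<Rightarrow> 'n mpoly \<Rightarrow> bool)"
proof (rule equivpI)
  show "reflp (idem_rel :: 'n mpoly \<Rightarrow> 'n mpoly \<Rightarrow> bool)"
    by (auto simp: reflp_def idem_rel_def idem_ideal_zero)
  show "symp (idem_rel :: 'n mpoly \<Rightarrow> 'n mpoly \<Rightarrow> bool)"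
  proof (rule sympI)
    fix p q :: "'n mpoly"
    assume "idem_rel p q"
    then have "- (p - q) \<in> idem_ideal"
      unfolding idem_rel_def by (rule idem_ideal_uminus)
    then show "idem_rel q p" by (simp add: idem_rel_def)
  qed
  show "transp (idem_rel :: 'n mpoly \<Rightarrow> 'n mpoly \<Rightarrow> bool)"
  proof (rule transpI)
    fix p q r :: "'n mpoly"
    assume "idem_rel p q" "idem_rel q r"
    then have "(p - q) + (q - r) \<in> idem_ideal"
      unfolding idem_rel_def by (rule idem_ideal_add)
    then show "idem_rel p r" by (simp add: idem_rel_def)
  qed
qed

text \<open>
  The quotient of the polynomial ring by the ideal of all \<open>x\<^sub>i\<^sup>2 - x\<^sub>i\<close>. The index set \<open>\<Omega>\<close> is the
  finite type \<open>'n\<close>, so that \<open>n = CARD('n)\<close>.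
\<close>

quotient_type 'n idem_ring = "'n mpoly" / idem_rel
  by (rule equivp_idem_rel)

lemma one_notin_idem_ideal: "(1 :: 'n mpoly) \<notin> idem_ideal"
proof
  interpret real_hom "\<lambda>x. x" by (rule real_hom_id)
  assume "(1 :: 'n mpoly) \<in> idem_ideal"
  then have "subst (\<lambda>x. x) (\<lambda>_. 0) (1 :: 'n mpoly) \<in> {0}"
    by (rule subst_in_ideal) auto
  then show False by (simp add: subst_one)
qed

instantiation idem_ring :: (type) comm_ring_1
begin

lift_definition zero_idem_ring :: "'a idem_ring" is 0 .
lift_definition one_idem_ring :: "'a idem_ring" is 1 .
lift_definition plus_idem_ring :: "'a idem_ring \<Rightarrow> 'a idem_ring \<Rightarrow> 'a idem_ring" is "(+)"
  unfolding idem_rel_def add_diff_add by (rule idem_ideal_add)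
lift_definition uminus_idem_ring :: "'a idem_ring \<Rightarrow> 'a idem_ring" is uminus
  unfolding idem_rel_def minus_diff_minus by (rule idem_ideal_uminus)
lift_definition minus_idem_ring :: "'a idem_ring \<Rightarrow> 'a idem_ring \<Rightarrow> 'a idem_ring" is "(-)"
proof -
  fix p p' q q' :: "'a mpoly"
  assume a: "idem_rel p p'" "idem_rel q q'"
  have "(p - q) - (p' - q') = (p - p') + - (q - q')"
    by simp
  then show "idem_rel (p - q) (p' - q')"
    using a unfolding idem_rel_def by (metis idem_ideal_add idem_ideal_uminus)
qed
lift_definition times_idem_ring :: "'a idem_ring \<Rightarrow> 'a idem_ring \<Rightarrow> 'a idem_ring" is "(*)"
proof -
  fix p p' q q' :: "'a mpoly"
  assume a: "idem_rel p p'" "idem_rel q q'"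
  have "p * q - p' * q' = q * (p - p') + p' * (q - q')"
    by (simp add: algebra_simps)
  then show "idem_rel (p * q) (p' * q')"
    using a unfolding idem_rel_def by (simp add: idem_ideal_add idem_ideal_mult)
qed

instance
proof
  show "(0 :: 'a idem_ring) \<noteq> 1"
    by transfer
      (use idem_ideal_uminus[of "- 1"] one_notin_idem_ideal in \<open>auto simp: idem_rel_def\<close>)
qed (transfer; simp add: algebra_simps idem_rel_def idem_ideal_zero)+

end

instantiation idem_ring :: (type) real_algebra_1
begin

lift_definition scaleR_idem_ring :: "real \<Rightarrow> 'a idem_ring \<Rightarrow> 'a idem_ring"
  is "\<lambda>c p. Poly_Mapping.single 0 c * p"
  unfolding idem_rel_def right_diff_distrib[symmetric] by (rule idem_ideal_mult)

instance
  by standard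
    (transfer; simp add: algebra_simps single_add mult_single idem_rel_def idem_ideal_zero
      flip: mult.assoc)+

end

lift_definition gen :: "'n \<Rightarrow> 'n idem_ring" is var .

definition pbasis :: "'n set \<Rightarrow> 'n idem_ring" where
  "pbasis A = (\<Prod>i\<in>A. gen i)"

lift_definition act :: "('n \<Rightarrow> 'n) \<Rightarrow> 'n idem_ring \<Rightarrow> 'n idem_ring"
  is "\<lambda>\<sigma>. subst (Poly_Mapping.single 0) (\<lambda>i. var (\<sigma> i))"
proof -
  fix \<sigma> :: "'n \<Rightarrow> 'n" and p q :: "'n mpoly"
  interpret real_hom "Poly_Mapping.single 0 :: real \<Rightarrow> 'n mpoly" by (rule real_hom_single)
  assume "idem_rel p q"
  then have "subst (Poly_Mapping.single 0) (\<lambda>i. var (\<sigma> i)) (p - q) \<in> idem_ideal"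
    unfolding idem_rel_def
    by (rule subst_in_ideal) (auto simp: idem_ideal_zero idem_ideal_add idem_ideal_mult idem_ideal_gen)
  then show "idem_rel (subst (Poly_Mapping.single 0) (\<lambda>i. var (\<sigma> i)) p)
      (subst (Poly_Mapping.single 0) (\<lambda>i. var (\<sigma> i)) q)"
    by (simp add: idem_rel_def subst_diff)
qed

lemma idem_rel_refl: "idem_rel p p"
  by (simp add: idem_rel_def idem_ideal_zero)

lemma act_add: "act \<sigma> (x + y) = act \<sigma> x + act \<sigma> y"
  by transfer (simp add: real_hom.subst_add[OF real_hom_single] idem_rel_refl)

lemma act_mult: "act \<sigma> (x * y) = act \<sigma> x * act \<sigma> y"
  by transfer (simp add: real_hom.subst_mult[OF real_hom_single] idem_rel_refl)

lemma act_one: "act \<sigma> 1 = 1"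
  by transfer (simp add: real_hom.subst_one[OF real_hom_single] idem_rel_refl)

lemma act_scaleR: "act \<sigma> (c *\<^sub>R x) = c *\<^sub>R act \<sigma> x"
  by transfer
    (simp add: real_hom.subst_mult[OF real_hom_single] real_hom.subst_single[OF real_hom_single]
      idem_rel_refl)

lemma act_gen: "act \<sigma> (gen i) = gen (\<sigma> i)"
  by transfer (simp add: real_hom.subst_var[OF real_hom_single] idem_rel_refl)

lemma act_pbasis:
  fixes \<sigma> :: "'n::finite \<Rightarrow> 'n"
  assumes "\<sigma> permutes UNIV"
  shows "act \<sigma> (pbasis A) = pbasis (\<sigma> ` A)"
proof -
  have "act \<sigma> (prod g B) = (\<Prod>i\<in>B. act \<sigma> (g i))" if "finite B" for g :: "'n \<Rightarrow> 'n idem_ring" and B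
    using that by (induction B) (simp_all add: act_one act_mult)
  moreover have "inj_on \<sigma> A"
    using assms permutes_inj inj_on_subset by blast
  ultimately show ?thesis
    by (simp add: pbasis_def act_gen prod.reindex)
qed

lemma gen_idem: "gen i * gen i = gen i"
  by transfer (use idem_ideal_gen in \<open>auto simp: idem_rel_def power2_eq_square\<close>)

lemma gen_power: "k > 0 \<Longrightarrow> gen i ^ k = gen i"
proof (induction k)
  case (Suc k)
  then show ?case by (cases k) (simp_all add: gen_idem)
qed simp

lemma span_pbasis: "span (range pbasis) = (UNIV :: 'n idem_ring set)"
proof -
  have monom: "abs_idem_ring (Poly_Mapping.single m c) =
      c *\<^sub>R (\<Prod>i\<in>Poly_Mapping.keys m. gen i ^ Poly_Mapping.lookup m i)"
    for m :: "'n \<Rightarrow>\<^sub>0 nat" and c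
  proof -
    interpret real_hom "of_real :: real \<Rightarrow> 'n idem_ring" by standard simp_all
    have abs_single: "abs_idem_ring (Poly_Mapping.single 0 c) = (of_real c :: 'n idem_ring)" for c
      unfolding of_real_def by transfer (simp add: idem_rel_refl)
    have powers: "abs_idem_ring (Poly_Mapping.single (Poly_Mapping.single i k) 1) = gen i ^ k"
      for i :: 'n and k
    proof (induction k)
      case 0
      show ?case by (simp add: one_idem_ring.abs_eq)
    next
      case (Suc k)
      have "Poly_Mapping.single (Poly_Mapping.single i (Suc k)) (1::real) =
          var i * Poly_Mapping.single (Poly_Mapping.single i k) 1"
        by (simp add: var_def mult_single flip: single_add)
      then show ?case
        by (simp add: Suc gen.abs_eq flip: times_idem_ring.abs_eq)
    qed
    have sums: "abs_idem_ring (Poly_Mapping.single (\<Sum>i\<in>B. Poly_Mapping.single i (g i)) 1) =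
        (\<Prod>i\<in>B. gen i ^ g i)" if "finite B" for B :: "'n set" and g
      using that
    proof (induction B)
      case empty
      show ?case by (simp add: one_idem_ring.abs_eq)
    next
      case (insert b B)
      have "Poly_Mapping.single (\<Sum>i\<in>insert b B. Poly_Mapping.single i (g i)) (1::real) =
          Poly_Mapping.single (Poly_Mapping.single b (g b)) 1 *
          Poly_Mapping.single (\<Sum>i\<in>B. Poly_Mapping.single i (g i)) 1"
        using insert.hyps by (simp add: mult_single)
      then show ?case
        using insert by (simp add: powers flip: times_idem_ring.abs_eq)
    qed
    have m: "m = (\<Sum>i\<in>Poly_Mapping.keys m. Poly_Mapping.single i (Poly_Mapping.lookup m i))"
    proof (rule poly_mapping_eqI)
      fix k
      have "(\<Sum>i\<in>Poly_Mapping.keys m. Poly_Mapping.lookup (Poly_Mapping.single i (Poly_Mapping.lookup m i)) k)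
          = (\<Sum>i\<in>Poly_Mapping.keys m. if i = k then Poly_Mapping.lookup m i else 0)"
        by (intro sum.cong) (auto simp: lookup_single when_def)
      then show "Poly_Mapping.lookup m k = Poly_Mapping.lookup
          (\<Sum>i\<in>Poly_Mapping.keys m. Poly_Mapping.single i (Poly_Mapping.lookup m i)) k"
        by (simp add: lookup_sum in_keys_iff)
    qed
    have "Poly_Mapping.single m c = Poly_Mapping.single 0 c * Poly_Mapping.single m 1"
      by (simp add: mult_single)
    then have "abs_idem_ring (Poly_Mapping.single m c) =
        c *\<^sub>R abs_idem_ring (Poly_Mapping.single m 1)"
      by (simp add: scaleR_idem_ring.abs_eq)
    then show ?thesis
      using sums[of "Poly_Mapping.keys m" "Poly_Mapping.lookup m"] m by simp
  qed
  have "abs_idem_ring p \<in> span (range pbasis)" for p :: "'n mpoly"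
  proof (induction p rule: mpoly_induct)
    case zero
    show ?case by (simp add: span_zero flip: zero_idem_ring.abs_eq)
  next
    case (add p q)
    then show ?case by (simp add: span_add flip: plus_idem_ring.abs_eq)
  next
    case (single m c)
    have "(\<Prod>i\<in>Poly_Mapping.keys m. gen i ^ Poly_Mapping.lookup m i) = pbasis (Poly_Mapping.keys m)"
      unfolding pbasis_def by (intro prod.cong) (auto simp: gen_power in_keys_iff)
    then show ?case
      by (simp add: monom span_scale span_base)
  qed
  then show ?thesis
    by (metis UNIV_eq_I Quotient_idem_ring Quotient_abs_rep)
qed

text \<open>
  Evaluation at the indicator vector of \<open>B\<close>; it sends \<open>p\<^sub>A\<close> to 1 if \<open>A \<subseteq> B\<close> and to 0 otherwise.
\<close>

lift_definition ev :: "'n set \<Rightarrow> 'n idem_ring \<Rightarrow> real"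
  is "\<lambda>B. subst (\<lambda>x. x) (\<lambda>i. if i \<in> B then 1 else 0)"
proof -
  fix B :: "'n set" and p q :: "'n mpoly"
  interpret real_hom "\<lambda>x. x" by (rule real_hom_id)
  assume "idem_rel p q"
  then have "subst (\<lambda>x. x) (\<lambda>i. if i \<in> B then 1 else 0) (p - q) \<in> {0 :: real}"
    unfolding idem_rel_def by (rule subst_in_ideal) auto
  then show "subst (\<lambda>x. x) (\<lambda>i. if i \<in> B then 1 else 0) p =
      subst (\<lambda>x. x) (\<lambda>i. if i \<in> B then 1 else (0 :: real)) q"
    by (simp add: subst_diff)
qed

lemma linear_ev: "linear (ev B)"
proof (rule linearI)
  show "ev B (x + y) = ev B x + ev B y" for x y
    by transfer (simp add: real_hom.subst_add[OF real_hom_id])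
  show "ev B (c *\<^sub>R x) = c *\<^sub>R ev B x" for c x
    by transfer (simp add: real_hom.subst_mult[OF real_hom_id] real_hom.subst_single[OF real_hom_id])
qed

lemma ev_pbasis:
  fixes A :: "'n::finite set"
  shows "ev B (pbasis A) = (if A \<subseteq> B then 1 else 0)"
proof -
  have mult: "ev B (x * y) = ev B x * ev B y" for x y :: "'n idem_ring"
    by transfer (simp add: real_hom.subst_mult[OF real_hom_id])
  have one: "ev B (1 :: 'n idem_ring) = 1"
    by transfer (simp add: real_hom.subst_one[OF real_hom_id])
  have gen: "ev B (gen i) = (if i \<in> B then 1 else 0)" for i
    by transfer (simp add: real_hom.subst_var[OF real_hom_id])
  have "finite A" by simp
  then show ?thesis
    unfolding pbasis_def by (induction A) (auto simp: one mult gen)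
qed

lemma pbasis_coeffs_zero:
  fixes u :: "'n::finite set \<Rightarrow> real"
  assumes "(\<Sum>A\<in>UNIV. u A *\<^sub>R pbasis A) = 0"
  shows "u B = 0"
proof (induction "card B" arbitrary: B rule: less_induct)
  case less
  have "0 = ev B (\<Sum>A\<in>UNIV. u A *\<^sub>R pbasis A)"
    by (simp add: assms linear_0[OF linear_ev])
  also have "\<dots> = (\<Sum>A\<in>UNIV. u A * ev B (pbasis A))"
    by (simp add: linear_sum[OF linear_ev] linear_scale[OF linear_ev])
  also have "\<dots> = (\<Sum>A\<in>{B}. u A * ev B (pbasis A))"
  proof (rule sum.mono_neutral_right)
    show "\<forall>A\<in>UNIV - {B}. u A * ev B (pbasis A) = 0"
      using less by (auto simp: ev_pbasis psubset_card_mono psubsetI)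
  qed auto
  finally show ?case by (simp add: ev_pbasis)
qed

lemma inj_pbasis: "inj (pbasis :: 'n::finite set \<Rightarrow> 'n idem_ring)"
proof (rule injI)
  fix A B :: "'n set"
  assume eq: "pbasis A = pbasis B"
  show "A = B"
    using ev_pbasis[of A A] ev_pbasis[of A B] ev_pbasis[of B A] ev_pbasis[of B B] eq
    by (metis subset_antisym subset_refl zero_neq_one)
qed

lemma independent_pbasis: "independent (range (pbasis :: 'n::finite set \<Rightarrow> 'n idem_ring))"
proof (subst real_vector.independent_explicit_finite_subsets, intro allI impI)
  fix S :: "'n idem_ring set" and u
  show "\<forall>v\<in>S. u v = 0" if S: "S \<subseteq> range pbasis" "finite S" "(\<Sum>v\<in>S. u v *\<^sub>R v) = 0"
  proof
    fix v assume v: "v \<in> S"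
    then obtain B where B: "v = pbasis B" using S by auto
    let ?w = "\<lambda>A. if pbasis A \<in> S then u (pbasis A) else 0"
    have "(\<Sum>A\<in>UNIV. ?w A *\<^sub>R pbasis A) = (\<Sum>x\<in>range pbasis. (if x \<in> S then u x else 0) *\<^sub>R x)"
      by (simp add: sum.reindex[OF inj_pbasis])
    also have "\<dots> = (\<Sum>v\<in>S. u v *\<^sub>R v)"
      by (rule sum.mono_neutral_cong_right) (use S in auto)
    finally have "?w B = 0"
      using S pbasis_coeffs_zero[of ?w B] by simp
    then show "u v = 0" using v B by simp
  qed
qed

lemma ex1_linear_pbasis:
  fixes g :: "'n::finite set \<Rightarrow> 'n idem_ring"
  shows "\<exists>!f. linear f \<and> (\<forall>A. f (pbasis A) = g A)"
proof -
  obtain f where f: "linear f"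
    "\<forall>x\<in>range pbasis. f x = g (the_inv pbasis x)"
    using linear_independent_extend[OF independent_pbasis, of "\<lambda>x. g (the_inv pbasis x)"] by blast
  show ?thesis
  proof (rule ex1I[of _ f])
    show "linear f \<and> (\<forall>A. f (pbasis A) = g A)"
      using f by (simp add: the_inv_f_f[OF inj_pbasis])
    show "h = f" if "linear h \<and> (\<forall>A. h (pbasis A) = g A)" for h
    proof
      fix x
      show "h x = f x"
        by (rule linear_eq_on[of h f x "range pbasis"])
          (use that f in \<open>auto simp: span_pbasis the_inv_f_f[OF inj_pbasis]\<close>)
    qed
  qed
qed

definition derivation :: "'n::finite idem_ring \<Rightarrow> 'n idem_ring" where
  "derivation = (THE f. linear f \<and> (\<forall>A. f (pbasis A) = (\<Sum>i\<in>A. pbasis (A - {i}))))"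

definition complementation :: "'n::finite idem_ring \<Rightarrow> 'n idem_ring" where
  "complementation = (THE f. linear f \<and> (\<forall>A. f (pbasis A) = pbasis (UNIV - A)))"

text \<open>Both descriptions are proper, because the \<open>p\<^sub>A\<close> form a basis.\<close>

lemma linear_derivation: "linear derivation"
  and derivation_pbasis: "derivation (pbasis A) = (\<Sum>i\<in>A. pbasis (A - {i}))"
  using theI'[OF ex1_linear_pbasis[of "\<lambda>A. \<Sum>i\<in>A. pbasis (A - {i})"]]
  unfolding derivation_def[symmetric] by auto

lemma linear_complementation: "linear complementation"
  and complementation_pbasis: "complementation (pbasis A) = pbasis (UNIV - A)"
  using theI'[OF ex1_linear_pbasis[of "\<lambda>A. pbasis (UNIV - A)"]]
  unfolding complementation_def[symmetric] by auto

definition Com :: "('n::finite idem_ring \<Rightarrow> 'n idem_ring) set" where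
  "Com = {h. linear h \<and> (\<forall>\<sigma>. \<sigma> permutes UNIV \<longrightarrow> h \<circ> act \<sigma> = act \<sigma> \<circ> h)}"

text \<open>
  The real algebra under composition generated by \<open>G\<close>. The identity is not added as a generator;
  since complementation is an involution, adding it would not enlarge the algebra considered here.
\<close>

inductive_set generated_algebra ::
  "('v \<Rightarrow> 'v) set \<Rightarrow> ('v::real_vector \<Rightarrow> 'v) set" for G where
  gen: "g \<in> G \<Longrightarrow> g \<in> generated_algebra G"
| zero: "(\<lambda>x. 0) \<in> generated_algebra G"
| add: "f \<in> generated_algebra G \<Longrightarrow> g \<in> generated_algebra G \<Longrightarrow>
    (\<lambda>x. f x + g x) \<in> generated_algebra G"
| scaleR: "f \<in> generated_algebra G \<Longrightarrow> (\<lambda>x. c *\<^sub>R f x) \<in> generated_algebra G"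
| comp: "f \<in> generated_algebra G \<Longrightarrow> g \<in> generated_algebra G \<Longrightarrow> f \<circ> g \<in> generated_algebra G"

end

theory Submission
  imports Defs "HOL-Library.Cardinality"
begin

text \<open>
  Both generators commute with permutations, so only one inclusion needs an idea: every
  equivariant map lies in the algebra generated by \<open>\<partial>\<close> and \<open>\<complement>\<close>. Write \<open>n\<close> for the number of variables
  and describe a linear map by its matrix, or kernel, \<open>k\<close> with respect to the basis \<open>p\<^sub>A\<close>:
  it sends \<open>p\<^sub>A\<close> to the sum over \<open>B\<close> of \<open>k A B\<close> times \<open>p\<^sub>B\<close>.

  A linear map is equivariant iff its kernel is constant on the orbits of the symmetric group on
  pairs \<open>(A, B)\<close>, and the orbit of a pair is determined by \<open>|A|\<close>, \<open>|B|\<close> and \<open>|A \<union> B|\<close>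
  (\<open>pair_transport\<close>). Hence the indicator functions of the orbits (\<open>orbit_kernel\<close>) span the kernels
  of equivariant maps, and it suffices to generate each of them.

  The conjugate \<open>U = \<complement> \<circ> \<partial> \<circ> \<complement>\<close> adds one element to a set in all possible ways, while \<open>\<partial>\<close> removes
  one. The two are the raising and lowering operators of a representation of \<open>sl\<^sub>2\<close>: their
  commutator \<open>\<partial> \<circ> U - U \<circ> \<partial>\<close> multiplies \<open>p\<^sub>A\<close> by \<open>n - 2|A|\<close> (\<open>derivation_commutator\<close>). These
  eigenvalues are distinct for distinct \<open>|A|\<close>, so Lagrange interpolation yields the projection onto
  each level, the span of all \<open>p\<^sub>A\<close> with \<open>|A| = i\<close> (\<open>level_projection_generated\<close>). Repeated derivation
  after a projection gives, up to a nonzero factor, the inclusion kernels between two levels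
  (\<open>down_generated\<close>), and conjugation by \<open>\<complement>\<close> gives their transposes (\<open>up_generated\<close>).

  Going up from level \<open>i\<close> to level \<open>u\<close> and then down to level \<open>j\<close> counts, for each pair \<open>(A, B)\<close>, the
  sets of size \<open>u\<close> that contain \<open>A \<union> B\<close>. If \<open>|A \<union> B| = v\<close>, this number is the binomial
  coefficient of \<open>n - v\<close> over \<open>u - v\<close>; it vanishes for \<open>v > u\<close> and equals 1 for \<open>v = u\<close>. The
  system that expresses these composites by the orbit indicators is thus unitriangular in \<open>u\<close>, and
  solving it puts every orbit indicator into the algebra (\<open>orbit_kernel_generated\<close>).
\<close>

section \<open>Operators and kernels\<close>

definition kernel_op :: "('n::finite set \<Rightarrow> 'n set \<Rightarrow> real) \<Rightarrow> 'n idem_ring \<Rightarrow> 'n idem_ring" where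
  "kernel_op k = (THE f. linear f \<and> (\<forall>A. f (pbasis A) = (\<Sum>B\<in>UNIV. k A B *\<^sub>R pbasis B)))"

lemma linear_kernel_op: "linear (kernel_op k)"
  and kernel_op_pbasis: "kernel_op k (pbasis A) = (\<Sum>B\<in>UNIV. k A B *\<^sub>R pbasis B)"
  using theI'[OF ex1_linear_pbasis[of "\<lambda>A. \<Sum>B\<in>UNIV. k A B *\<^sub>R pbasis B"]]
  unfolding kernel_op_def[symmetric] by auto

lemma linear_eqI_pbasis:
  fixes f g :: "'n::finite idem_ring \<Rightarrow> 'n idem_ring"
  assumes "linear f" "linear g" "\<And>A. f (pbasis A) = g (pbasis A)"
  shows "f = g"
  using ex1_linear_pbasis[of "\<lambda>A. g (pbasis A)"] assms by blast

lemma kernel_op_eqI: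
  assumes "linear f" "\<And>A. f (pbasis A) = (\<Sum>B\<in>UNIV. k A B *\<^sub>R pbasis B)"
  shows "f = kernel_op k"
  by (rule linear_eqI_pbasis) (simp_all add: assms linear_kernel_op kernel_op_pbasis)

lemma ex_pbasis_coeffs:
  fixes x :: "'n::finite idem_ring"
  obtains u where "x = (\<Sum>B\<in>UNIV. u B *\<^sub>R pbasis B)"
proof -
  have "x \<in> span (range pbasis)"
    by (simp add: span_pbasis)
  then obtain w where "x = (\<Sum>v\<in>range pbasis. w v *\<^sub>R v)"
    by (auto simp: span_finite)
  then have "x = (\<Sum>B\<in>UNIV. w (pbasis B) *\<^sub>R pbasis B)"
    by (simp add: sum.reindex[OF inj_pbasis])
  then show thesis by (rule that)
qed

lemma pbasis_coeffs_unique: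
  fixes u w :: "'n::finite set \<Rightarrow> real"
  assumes "(\<Sum>B\<in>UNIV. u B *\<^sub>R pbasis B) = (\<Sum>B\<in>UNIV. w B *\<^sub>R pbasis B)"
  shows "u B = w B"
proof -
  have "(\<Sum>B\<in>UNIV. (u B - w B) *\<^sub>R pbasis B) = 0"
    using assms by (simp add: scaleR_left_diff_distrib sum_subtractf)
  from pbasis_coeffs_zero[OF this, of B] show ?thesis by simp
qed

lemma ex_kernel:
  fixes h :: "'n::finite idem_ring \<Rightarrow> 'n idem_ring"
  assumes "linear h"
  obtains k where "h = kernel_op k"
proof -
  have "\<exists>u. h (pbasis A) = (\<Sum>B\<in>UNIV. u B *\<^sub>R pbasis B)" for A
    by (metis ex_pbasis_coeffs)
  then obtain k where "\<And>A. h (pbasis A) = (\<Sum>B\<in>UNIV. k A B *\<^sub>R pbasis B)"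
    by metis
  with assms show thesis
    by (intro that[of k] kernel_op_eqI)
qed

lemma derivation_generated: "derivation \<in> generated_algebra {derivation, complementation}"
  and complementation_generated: "complementation \<in> generated_algebra {derivation, complementation}"
  by (simp_all add: generated_algebra.gen)

text \<open>
  Kernels turn the generated algebra into a set of matrices, so that membership of a map is settled
  by identities between real numbers that count sets.
\<close>

definition generated_kernels :: "('n::finite set \<Rightarrow> 'n set \<Rightarrow> real) set" where
  "generated_kernels = {k. kernel_op k \<in> generated_algebra {derivation, complementation}}"

lemma generated_kernels_zero: "(\<lambda>A B :: 'n::finite set. 0) \<in> generated_kernels"
proof -
  have "(\<lambda>x. 0) = kernel_op (\<lambda>A B :: 'n set. 0)"
    by (rule kernel_op_eqI) (simp_all add: module_hom_zero)
  then show ?thesis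
    using generated_algebra.zero unfolding generated_kernels_def by (metis mem_Collect_eq)
qed

lemma generated_kernels_add:
  assumes "k \<in> generated_kernels" "l \<in> generated_kernels"
  shows "(\<lambda>A B. k A B + l A B) \<in> generated_kernels"
proof -
  have "(\<lambda>x. kernel_op k x + kernel_op l x) = kernel_op (\<lambda>A B. k A B + l A B)"
    by (rule kernel_op_eqI)
      (simp_all add: linear_compose_add linear_kernel_op kernel_op_pbasis scaleR_left_distrib
        sum.distrib)
  then show ?thesis
    using generated_algebra.add[of "kernel_op k" _ "kernel_op l"] assms
    by (simp add: generated_kernels_def)
qed

lemma generated_kernels_scale:
  assumes "k \<in> generated_kernels"
  shows "(\<lambda>A B. c * k A B) \<in> generated_kernels"
proof -
  have "(\<lambda>x. c *\<^sub>R kernel_op k x) = kernel_op (\<lambda>A B. c * k A B)"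
    by (rule kernel_op_eqI)
      (simp_all add: linear_compose_scale_right linear_kernel_op kernel_op_pbasis
        scaleR_sum_right)
  then show ?thesis
    using generated_algebra.scaleR[of "kernel_op k" _ c] assms by (simp add: generated_kernels_def)
qed

lemma generated_kernels_diff:
  assumes "k \<in> generated_kernels" "l \<in> generated_kernels"
  shows "(\<lambda>A B. k A B - l A B) \<in> generated_kernels"
  using generated_kernels_add[OF assms(1) generated_kernels_scale[OF assms(2), of "-1"]] by simp

lemma generated_kernels_sum:
  assumes "\<And>i. i \<in> I \<Longrightarrow> k i \<in> generated_kernels"
  shows "(\<lambda>A B. \<Sum>i\<in>I. k i A B) \<in> generated_kernels"
  using assms
  by (induction I rule: infinite_finite_induct)
    (simp_all add: generated_kernels_zero generated_kernels_add)

lemma kernel_op_comp: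
  "kernel_op k \<circ> kernel_op l = kernel_op (\<lambda>A B. \<Sum>C\<in>UNIV. l A C * k C B)"
proof (rule kernel_op_eqI)
  show "linear (kernel_op k \<circ> kernel_op l)"
    by (simp add: linear_compose linear_kernel_op)
  fix A
  have "(kernel_op k \<circ> kernel_op l) (pbasis A) =
      (\<Sum>C\<in>UNIV. \<Sum>B\<in>UNIV. (l A C * k C B) *\<^sub>R pbasis B)"
    by (simp add: kernel_op_pbasis linear_sum[OF linear_kernel_op]
        linear_scale[OF linear_kernel_op] scaleR_sum_right)
  also have "\<dots> = (\<Sum>B\<in>UNIV. (\<Sum>C\<in>UNIV. l A C * k C B) *\<^sub>R pbasis B)"
    by (subst sum.swap) (simp add: scaleR_sum_left)
  finally show "(kernel_op k \<circ> kernel_op l) (pbasis A) = \<dots>" .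
qed

text \<open>
  The arguments are swapped: kernels map row index to column index from left to right, whereas
  composition applies the right factor first.
\<close>

lemma generated_kernels_comp:
  assumes "k \<in> generated_kernels" "l \<in> generated_kernels"
  shows "(\<lambda>A B. \<Sum>C\<in>UNIV. l A C * k C B) \<in> generated_kernels"
  using generated_algebra.comp[of "kernel_op k" _ "kernel_op l"] assms
  by (simp add: generated_kernels_def kernel_op_comp)

lemma generated_kernels_compl_right:
  assumes "k \<in> generated_kernels"
  shows "(\<lambda>A B. k A (- B)) \<in> generated_kernels"
proof -
  have "complementation \<circ> kernel_op k = kernel_op (\<lambda>A B. k A (- B))"
  proof (rule kernel_op_eqI)
    show "linear (complementation \<circ> kernel_op k)"
      by (simp add: linear_compose linear_kernel_op linear_complementation)
    fix A
    have "(complementation \<circ> kernel_op k) (pbasis A) = (\<Sum>B\<in>UNIV. k A B *\<^sub>R pbasis (- B))"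
      by (simp add: kernel_op_pbasis linear_sum[OF linear_complementation]
          linear_scale[OF linear_complementation] complementation_pbasis Compl_eq_Diff_UNIV)
    also have "\<dots> = (\<Sum>B\<in>UNIV. k A (- B) *\<^sub>R pbasis B)"
      by (rule sum.reindex_bij_witness[of _ uminus uminus]) auto
    finally show "(complementation \<circ> kernel_op k) (pbasis A) = \<dots>" .
  qed
  then show ?thesis
    using generated_algebra.comp[OF complementation_generated, of "kernel_op k"] assms
    by (simp add: generated_kernels_def)
qed

lemma generated_kernels_compl_left:
  assumes "k \<in> generated_kernels"
  shows "(\<lambda>A. k (- A)) \<in> generated_kernels"
proof -
  have "kernel_op k \<circ> complementation = kernel_op (\<lambda>A. k (- A))"
    by (rule kernel_op_eqI)
      (simp_all add: linear_compose linear_kernel_op linear_complementation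
        complementation_pbasis kernel_op_pbasis Compl_eq_Diff_UNIV)
  then show ?thesis
    using generated_algebra.comp[OF _ complementation_generated, of "kernel_op k"] assms
    by (simp add: generated_kernels_def)
qed

section \<open>Projections onto the levels\<close>

definition diag :: "(nat \<Rightarrow> real) \<Rightarrow> 'n::finite set \<Rightarrow> 'n set \<Rightarrow> real" where
  "diag \<phi> A B = (if A = B then \<phi> (card A) else 0)"

lemma kernel_op_diag_pbasis: "kernel_op (diag \<phi>) (pbasis A) = \<phi> (card A) *\<^sub>R pbasis A"
proof -
  have "kernel_op (diag \<phi>) (pbasis A) =
      (\<Sum>B\<in>UNIV. if A = B then \<phi> (card A) *\<^sub>R pbasis B else 0)"
    unfolding kernel_op_pbasis diag_def by (intro sum.cong) auto
  then show ?thesis by simp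
qed

text \<open>
  The generated algebra contains the identity because complementation is an involution.
\<close>

lemma diag_const_generated: "(diag (\<lambda>_. c) :: 'n::finite set \<Rightarrow> _) \<in> generated_kernels"
proof -
  have "complementation \<circ> complementation =
      (kernel_op (diag (\<lambda>_. 1)) :: 'n idem_ring \<Rightarrow> _)"
    by (rule linear_eqI_pbasis)
      (simp_all add: linear_compose linear_complementation linear_kernel_op kernel_op_diag_pbasis
        complementation_pbasis flip: Compl_eq_Diff_UNIV)
  then have "(diag (\<lambda>_. 1) :: 'n set \<Rightarrow> _) \<in> generated_kernels"
    using generated_algebra.comp[OF complementation_generated complementation_generated]
    unfolding generated_kernels_def by (metis mem_Collect_eq)
  from generated_kernels_scale[OF this, of c] show ?thesis
    by (rule back_subst[of "\<lambda>k. k \<in> generated_kernels"]) (auto simp: diag_def fun_eq_iff)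
qed

lemma diag_mult_generated:
  assumes "(diag \<phi> :: 'n::finite set \<Rightarrow> _) \<in> generated_kernels"
    "(diag \<psi> :: 'n set \<Rightarrow> _) \<in> generated_kernels"
  shows "(diag (\<lambda>m. \<phi> m * \<psi> m) :: 'n set \<Rightarrow> _) \<in> generated_kernels"
proof -
  have "(\<Sum>C\<in>UNIV. diag \<phi> A C * diag \<psi> C B) = diag (\<lambda>m. \<phi> m * \<psi> m) A B" for A B :: "'n set"
  proof -
    have "(\<Sum>C\<in>UNIV. diag \<phi> A C * diag \<psi> C B) =
        (\<Sum>C\<in>UNIV. if A = C then \<phi> (card A) * diag \<psi> A B else 0)"
      by (intro sum.cong) (auto simp: diag_def)
    then show ?thesis by (simp add: diag_def)
  qed
  with generated_kernels_comp[OF assms(2,1)] show ?thesis by simp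
qed

text \<open>
  Adding \<open>j \<notin> A\<close> and removing \<open>i \<in> A\<close> commute. The two composites differ only in the terms that
  return to \<open>A\<close>: there are \<open>n - |A|\<close> of them if an element is added first, and \<open>|A|\<close> if one is removed
  first.
\<close>

lemma derivation_commutator:
  fixes A :: "'n::finite set"
  defines "raising \<equiv> complementation \<circ> derivation \<circ> (complementation :: 'n idem_ring \<Rightarrow> _)"
  shows "derivation (raising (pbasis A)) - raising (derivation (pbasis A)) =
    (real CARD('n) - 2 * real (card A)) *\<^sub>R pbasis A"
proof -
  have lin: "linear raising"
    unfolding raising_def by (simp add: linear_compose linear_derivation linear_complementation)
  have raise: "raising (pbasis B) = (\<Sum>j\<in>- B. pbasis (insert j B))" for B
    unfolding raising_def
    by (auto simp: complementation_pbasis derivation_pbasis linear_sum[OF linear_complementation]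
        Compl_eq_Diff_UNIV intro!: sum.cong arg_cong[of _ _ pbasis])
  let ?S = "\<Sum>j\<in>- A. \<Sum>i\<in>A. pbasis (insert j (A - {i}))"
  have "derivation (raising (pbasis A)) = (\<Sum>j\<in>- A. \<Sum>i\<in>insert j A. pbasis (insert j A - {i}))"
    by (simp add: raise linear_sum[OF linear_derivation] derivation_pbasis)
  also have "\<dots> = (\<Sum>j\<in>- A. pbasis A + (\<Sum>i\<in>A. pbasis (insert j (A - {i}))))"
  proof (rule sum.cong)
    fix j assume j: "j \<in> - A"
    then have "insert j A - {i} = insert j (A - {i})" if "i \<in> A" for i
      using that by auto
    then show "(\<Sum>i\<in>insert j A. pbasis (insert j A - {i})) =
        pbasis A + (\<Sum>i\<in>A. pbasis (insert j (A - {i})))"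
      using j by simp
  qed simp
  also have "\<dots> = real (card (- A)) *\<^sub>R pbasis A + ?S"
    by (simp add: sum.distrib sum_constant_scaleR del: sum_constant)
  finally have du: "derivation (raising (pbasis A)) = real (card (- A)) *\<^sub>R pbasis A + ?S" .
  have "raising (derivation (pbasis A)) = (\<Sum>i\<in>A. \<Sum>j\<in>- (A - {i}). pbasis (insert j (A - {i})))"
    by (simp add: derivation_pbasis linear_sum[OF lin] raise)
  also have "\<dots> = (\<Sum>i\<in>A. pbasis A + (\<Sum>j\<in>- A. pbasis (insert j (A - {i}))))"
  proof (rule sum.cong)
    fix i assume i: "i \<in> A"
    then have "- (A - {i}) = insert i (- A)" "insert i (A - {i}) = A"
      by auto
    then show "(\<Sum>j\<in>- (A - {i}). pbasis (insert j (A - {i}))) =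
        pbasis A + (\<Sum>j\<in>- A. pbasis (insert j (A - {i})))"
      using i by simp
  qed simp
  also have "\<dots> = real (card A) *\<^sub>R pbasis A + ?S"
    by (subst sum.swap) (simp add: sum.distrib sum_constant_scaleR del: sum_constant)
  finally have ud: "raising (derivation (pbasis A)) = real (card A) *\<^sub>R pbasis A + ?S" .
  have "real (card (- A)) = real CARD('n) - real (card A)"
    by (simp add: Compl_eq_Diff_UNIV card_Diff_subset of_nat_diff card_mono)
  then show ?thesis
    by (simp add: du ud flip: scaleR_left_diff_distrib)
qed

lemma diag_card_generated: "(diag real :: 'n::finite set \<Rightarrow> _) \<in> generated_kernels"
proof -
  let ?G = "generated_algebra {derivation, complementation :: 'n idem_ring \<Rightarrow> _}"
  let ?raising = "complementation \<circ> derivation \<circ> (complementation :: 'n idem_ring \<Rightarrow> _)"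
  let ?\<phi> = "\<lambda>m. real CARD('n) - 2 * real m"
  have lin: "linear ?raising"
    by (simp add: linear_compose linear_derivation linear_complementation)
  have raising: "?raising \<in> ?G"
    by (intro generated_algebra.comp derivation_generated complementation_generated)
  have "(\<lambda>x. (derivation \<circ> ?raising) x + (-1) *\<^sub>R (?raising \<circ> derivation) x) =
      kernel_op (diag ?\<phi>)"
  proof (rule linear_eqI_pbasis)
    show "linear (\<lambda>x. (derivation \<circ> ?raising) x + (-1) *\<^sub>R (?raising \<circ> derivation) x)"
      by (intro linear_compose_add linear_compose_scale_right linear_compose lin
          linear_derivation linear_complementation)
    show "linear (kernel_op (diag ?\<phi>))"
      by (rule linear_kernel_op)
    fix A :: "'n set"
    show "(derivation \<circ> ?raising) (pbasis A) + (-1) *\<^sub>R (?raising \<circ> derivation) (pbasis A) =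
        kernel_op (diag ?\<phi>) (pbasis A)"
      using derivation_commutator[of A] by (simp add: kernel_op_diag_pbasis)
  qed
  moreover have "(\<lambda>x. (derivation \<circ> ?raising) x + (-1) *\<^sub>R (?raising \<circ> derivation) x) \<in> ?G"
    by (intro generated_algebra.add generated_algebra.scaleR
        generated_algebra.comp[OF derivation_generated raising] generated_algebra.comp[OF raising derivation_generated])
  ultimately have "(diag ?\<phi> :: 'n set \<Rightarrow> _) \<in> generated_kernels"
    by (simp add: generated_kernels_def)
  from generated_kernels_scale[OF generated_kernels_diff[OF
        diag_const_generated[of "real CARD('n)"] this], of "1/2"]
  show ?thesis
    by (rule back_subst[of "\<lambda>k. k \<in> generated_kernels"]) (auto simp: diag_def fun_eq_iff)
qed

lemma diag_prod_generated:
  assumes "finite M"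
  shows "(diag (\<lambda>m. \<Prod>r\<in>M. real m - r) :: 'n::finite set \<Rightarrow> _) \<in> generated_kernels"
  using assms
proof (induction M)
  case empty
  show ?case by (simp add: diag_const_generated)
next
  case (insert r M)
  have "(\<lambda>A B. diag real A B - diag (\<lambda>_. r) A B) = (diag (\<lambda>m. real m - r) :: 'n set \<Rightarrow> _)"
    by (auto simp: diag_def fun_eq_iff)
  with generated_kernels_diff[OF diag_card_generated diag_const_generated]
  have "(diag (\<lambda>m. real m - r) :: 'n set \<Rightarrow> _) \<in> generated_kernels"
    by (rule back_subst[of "\<lambda>k. k \<in> generated_kernels"])
  with insert show ?case by (simp add: diag_mult_generated)
qed

text \<open>
  Lagrange interpolation: the product of \<open>x - r\<close> over all levels \<open>r \<noteq> i\<close>, divided by its value at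
  \<open>i\<close>, is 1 at \<open>i\<close> and 0 at every other level.
\<close>

lemma level_projection_generated:
  "(diag (\<lambda>m. of_bool (m = i)) :: 'n::finite set \<Rightarrow> _) \<in> generated_kernels"
proof -
  let ?M = "real ` ({..CARD('n)} - {i})"
  let ?\<phi> = "\<lambda>m. \<Prod>r\<in>?M. real m - r"
  have "(diag (\<lambda>m. of_bool (m = i)) :: 'n set \<Rightarrow> _) = (\<lambda>A B. 1 / ?\<phi> i * diag ?\<phi> A B)"
  proof (intro ext)
    fix A B :: "'n set"
    \<comment> \<open>This holds even if \<open>i\<close> exceeds the number of variables; then both sides vanish on all sets.\<close>
    have "?\<phi> i \<noteq> 0" by auto
    moreover have "?\<phi> (card A) = 0" if "card A \<noteq> i"
      using that card_mono[of UNIV A] by auto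
    ultimately show "diag (\<lambda>m. of_bool (m = i)) A B = 1 / ?\<phi> i * diag ?\<phi> A B"
      by (auto simp: diag_def)
  qed
  then show ?thesis
    by (simp only:) (intro generated_kernels_scale diag_prod_generated, simp)
qed

section \<open>Inclusion kernels\<close>

text \<open>
  This count is used twice: for the factor that a further derivation contributes to an inclusion
  kernel, and for the entries of the composite of going up and going down.
\<close>

lemma card_subsets_between:
  assumes "finite A" "B \<subseteq> A"
  shows "card {C. B \<subseteq> C \<and> C \<subseteq> A \<and> card C = c} =
    (if card B \<le> c then (card A - card B) choose (c - card B) else 0)"
proof (cases "card B \<le> c")
  case True
  have fin: "finite B" using assms finite_subset by blast
  have "bij_betw (\<lambda>D. D \<union> B) {D. D \<subseteq> A - B \<and> card D = c - card B}
      {C. B \<subseteq> C \<and> C \<subseteq> A \<and> card C = c}"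
  proof (rule bij_betwI[where g = "\<lambda>C. C - B"])
    show "(\<lambda>D. D \<union> B) \<in> {D. D \<subseteq> A - B \<and> card D = c - card B} \<rightarrow>
        {C. B \<subseteq> C \<and> C \<subseteq> A \<and> card C = c}"
    proof
      fix D assume "D \<in> {D. D \<subseteq> A - B \<and> card D = c - card B}"
      moreover from this have "card (D \<union> B) = card D + card B"
        using fin assms by (intro card_Un_disjoint) (auto intro: finite_subset)
      ultimately show "D \<union> B \<in> {C. B \<subseteq> C \<and> C \<subseteq> A \<and> card C = c}"
        using True assms by auto
    qed
    show "(\<lambda>C. C - B) \<in> {C. B \<subseteq> C \<and> C \<subseteq> A \<and> card C = c} \<rightarrow>
        {D. D \<subseteq> A - B \<and> card D = c - card B}"
      using fin by (auto simp: card_Diff_subset)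
  qed auto
  then have "card {C. B \<subseteq> C \<and> C \<subseteq> A \<and> card C = c} = card (A - B) choose (c - card B)"
    using assms n_subsets[of "A - B" "c - card B"] by (simp flip: bij_betw_same_card)
  then show ?thesis
    using True assms fin by (simp add: card_Diff_subset)
next
  case False
  then have "{C. B \<subseteq> C \<and> C \<subseteq> A \<and> card C = c} = {}"
    using assms by (auto dest: card_mono[OF finite_subset])
  then show ?thesis using False by (simp only: card.empty if_False)
qed

definition down :: "nat \<Rightarrow> nat \<Rightarrow> 'n::finite set \<Rightarrow> 'n set \<Rightarrow> real" where
  "down i j A B = of_bool (card A = i \<and> card B = j \<and> B \<subseteq> A)"

definition up :: "nat \<Rightarrow> nat \<Rightarrow> 'n::finite set \<Rightarrow> 'n set \<Rightarrow> real" where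
  "up i j A B = of_bool (card A = i \<and> card B = j \<and> A \<subseteq> B)"

lemma derivation_kernel:
  "(derivation :: 'n::finite idem_ring \<Rightarrow> _) =
    kernel_op (\<lambda>A B. of_bool (B \<subseteq> A \<and> card A = Suc (card B)))"
proof (rule kernel_op_eqI)
  fix A :: "'n set"
  have "(\<Sum>B\<in>UNIV. of_bool (B \<subseteq> A \<and> card A = Suc (card B)) *\<^sub>R pbasis B) =
      (\<Sum>B\<in>{B. B \<subseteq> A \<and> card A = Suc (card B)}. pbasis B)"
    by (rule sum.mono_neutral_cong_right) auto
  also have "{B. B \<subseteq> A \<and> card A = Suc (card B)} = (\<lambda>i. A - {i}) ` A"
  proof (intro equalityI subsetI)
    fix B assume B: "B \<in> {B. B \<subseteq> A \<and> card A = Suc (card B)}"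
    then have "card (A - B) = 1" by (simp add: card_Diff_subset)
    then obtain i where "A - B = {i}" by (rule card_1_singletonE)
    with B show "B \<in> (\<lambda>i. A - {i}) ` A" by blast
  next
    fix B assume "B \<in> (\<lambda>i. A - {i}) ` A"
    then show "B \<in> {B. B \<subseteq> A \<and> card A = Suc (card B)}"
      using card_Suc_Diff1[of A] by fastforce
  qed
  also have "(\<Sum>B\<in>(\<lambda>i. A - {i}) ` A. pbasis B) = (\<Sum>i\<in>A. pbasis (A - {i}))"
    by (subst sum.reindex) (auto intro: inj_onI)
  finally show "derivation (pbasis A) =
      (\<Sum>B\<in>UNIV. of_bool (B \<subseteq> A \<and> card A = Suc (card B)) *\<^sub>R pbasis B)"
    by (simp add: derivation_pbasis)
qed (rule linear_derivation)

text \<open>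
  Descending induction on \<open>j\<close>, starting from the projection onto level \<open>i\<close>. If \<open>B \<subseteq> A\<close> with
  \<open>|B| = j\<close>, exactly \<open>i - j\<close> sets of size \<open>j + 1\<close> lie between them, so one more derivation gives
  \<open>i - j\<close> times the next inclusion kernel.
\<close>

lemma down_generated:
  assumes "j \<le> i"
  shows "(down i j :: 'n::finite set \<Rightarrow> _) \<in> generated_kernels"
  using assms
proof (induction rule: inc_induct)
  case base
  have "(down i i :: 'n set \<Rightarrow> _) = diag (\<lambda>m. of_bool (m = i))"
    by (auto simp: fun_eq_iff down_def diag_def dest: card_subset_eq[rotated])
  then show ?case by (simp add: level_projection_generated)
next
  case (step j)
  let ?d = "\<lambda>A B :: 'n set. of_bool (B \<subseteq> A \<and> card A = Suc (card B)) :: real"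
  have "?d \<in> generated_kernels"
    by (simp add: generated_kernels_def generated_algebra.gen flip: derivation_kernel)
  then have "(\<lambda>A B. \<Sum>C\<in>UNIV. down i (Suc j) A C * ?d C B) \<in> generated_kernels"
    using step.IH by (rule generated_kernels_comp)
  also have "(\<lambda>A B. \<Sum>C\<in>UNIV. down i (Suc j) A C * ?d C B) = (\<lambda>A B. real (i - j) * down i j A B)"
  proof (intro ext)
    fix A B :: "'n set"
    have "(\<Sum>C\<in>UNIV. down i (Suc j) A C * ?d C B) =
        (\<Sum>C\<in>{C. B \<subseteq> C \<and> C \<subseteq> A \<and> card C = Suc j}. of_bool (card A = i \<and> card B = j))"
      by (rule sum.mono_neutral_cong_right) (auto simp: down_def)
    also have "\<dots> = real (card {C. B \<subseteq> C \<and> C \<subseteq> A \<and> card C = Suc j}) *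
        of_bool (card A = i \<and> card B = j)"
      by simp
    also have "\<dots> = real (i - j) * down i j A B"
    proof (cases "B \<subseteq> A")
      case True
      then show ?thesis
        by (simp add: card_subsets_between down_def Suc_diff_le)
    next
      case False
      then have "{C. B \<subseteq> C \<and> C \<subseteq> A \<and> card C = Suc j} = {}" by auto
      with False show ?thesis by (simp only: down_def) simp
    qed
    finally show "(\<Sum>C\<in>UNIV. down i (Suc j) A C * ?d C B) = real (i - j) * down i j A B" .
  qed
  finally have "(\<lambda>A B. real (i - j) * down i j A B) \<in>
      (generated_kernels :: ('n set \<Rightarrow> _) set)" .
  from generated_kernels_scale[OF this, of "1 / real (i - j)"] step.hyps show ?case
    by simp
qed

text \<open>
  Complementation reverses inclusion and exchanges the levels \<open>m\<close> and \<open>n - m\<close>.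
\<close>

lemma up_generated:
  assumes "i \<le> j" "j \<le> CARD('n)"
  shows "(up i j :: 'n::finite set \<Rightarrow> _) \<in> generated_kernels"
proof -
  let ?n = "CARD('n)"
  have "(down (?n - i) (?n - j) :: 'n set \<Rightarrow> _) \<in> generated_kernels"
    using assms by (intro down_generated) simp
  then have "(\<lambda>A B. down (?n - i) (?n - j) (- A) (- B)) \<in>
      (generated_kernels :: ('n set \<Rightarrow> _) set)"
    using generated_kernels_compl_left generated_kernels_compl_right by blast
  moreover have "down (?n - i) (?n - j) (- A) (- B) = up i j A B" for A B :: "'n set"
  proof -
    have "card (- C) = ?n - m \<longleftrightarrow> card C = m" if "m \<le> ?n" for C :: "'n set" and m
      using that card_mono[of UNIV C] by (simp add: Compl_eq_Diff_UNIV card_Diff_subset) linarith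
    then show ?thesis using assms by (auto simp: down_def up_def)
  qed
  ultimately show ?thesis by simp
qed

section \<open>Orbit kernels\<close>

definition orbit_kernel :: "nat \<Rightarrow> nat \<Rightarrow> nat \<Rightarrow> 'n::finite set \<Rightarrow> 'n set \<Rightarrow> real" where
  "orbit_kernel i j u A B = of_bool (card A = i \<and> card B = j \<and> card (A \<union> B) = u)"

text \<open>
  The entry at \<open>(A, B)\<close> is the number of sets of size \<open>u\<close> that contain \<open>A \<union> B\<close>, which depends on
  \<open>|A \<union> B|\<close> only.
\<close>

lemma up_down_kernel:
  fixes A B :: "'n::finite set"
  shows "(\<Sum>C\<in>UNIV. up i u A C * down u j C B) =
    (\<Sum>v\<le>u. real ((CARD('n) - v) choose (u - v)) * orbit_kernel i j v A B)"
proof -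
  have "(\<Sum>C\<in>UNIV. up i u A C * down u j C B) =
      (\<Sum>C\<in>{C. A \<union> B \<subseteq> C \<and> C \<subseteq> UNIV \<and> card C = u}. of_bool (card A = i \<and> card B = j))"
    by (rule sum.mono_neutral_cong_right) (auto simp: up_def down_def)
  also have "\<dots> = of_bool (card A = i \<and> card B = j) *
      (if card (A \<union> B) \<le> u
       then real ((CARD('n) - card (A \<union> B)) choose (u - card (A \<union> B))) else 0)"
    by (subst sum_constant, subst card_subsets_between) simp_all
  also have "\<dots> = of_bool (card A = i \<and> card B = j) *
      (\<Sum>v\<le>u. if card (A \<union> B) = v then real ((CARD('n) - v) choose (u - v)) else 0)"
    by simp
  also have "\<dots> = (\<Sum>v\<le>u. real ((CARD('n) - v) choose (u - v)) * orbit_kernel i j v A B)"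
    unfolding sum_distrib_left by (intro sum.cong) (auto simp: orbit_kernel_def)
  finally show ?thesis .
qed

text \<open>
  In \<open>up_down_kernel\<close> the coefficient at \<open>v = u\<close> is 1, so the orbit kernel for \<open>u\<close> is the composite
  minus a combination of orbit kernels for smaller \<open>v\<close>. Outside the range
  \<open>max i j \<le> u \<le> n\<close> there is no such pair of sets and the kernel is zero.
\<close>

lemma orbit_kernel_generated:
  "(orbit_kernel i j u :: 'n::finite set \<Rightarrow> _) \<in> generated_kernels"
proof (induction u rule: less_induct)
  case (less u)
  show ?case
  proof (cases "i \<le> u \<and> j \<le> u \<and> u \<le> CARD('n)")
    case True
    let ?c = "\<lambda>v. real ((CARD('n) - v) choose (u - v))"
    have "orbit_kernel i j u A B = (\<Sum>C\<in>UNIV. up i u A C * down u j C B) -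
        (\<Sum>v<u. ?c v * orbit_kernel i j v A B)" for A B :: "'n set"
      by (simp add: up_down_kernel flip: lessThan_Suc_atMost)
    moreover have "(\<lambda>A B :: 'n set. (\<Sum>C\<in>UNIV. up i u A C * down u j C B) -
        (\<Sum>v<u. ?c v * orbit_kernel i j v A B)) \<in> generated_kernels"
      using True less.IH
      by (intro generated_kernels_diff generated_kernels_comp generated_kernels_sum
          generated_kernels_scale up_generated down_generated) auto
    ultimately show ?thesis by presburger
  next
    case False
    have "card A \<le> card (A \<union> B)" "card B \<le> card (A \<union> B)" "card (A \<union> B) \<le> CARD('n)"
      for A B :: "'n set"
      by (auto intro: card_mono)
    with False have "(orbit_kernel i j u :: 'n set \<Rightarrow> _) = (\<lambda>A B. 0)"
      by (fastforce simp: orbit_kernel_def fun_eq_iff)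
    then show ?thesis by (simp add: generated_kernels_zero)
  qed
qed

text \<open>
  The pair \<open>(A, B)\<close> splits the index set into four cells, whose sizes are determined by the three
  given cardinalities; a permutation can carry the cells of one pair to those of the other.
\<close>

lemma pair_transport:
  fixes A B A' B' :: "'n::finite set"
  assumes "card A = card A'" "card B = card B'" "card (A \<union> B) = card (A' \<union> B')"
  obtains \<sigma> where "\<sigma> permutes UNIV" "\<sigma> ` A = A'" "\<sigma> ` B = B'"
proof -
  let ?f = "\<lambda>x. (x \<in> A, x \<in> B)" and ?f' = "\<lambda>x. (x \<in> A', x \<in> B')"
  have int: "card (A \<inter> B) = card (A' \<inter> B')"
    using assms card_Un_Int[of A B] card_Un_Int[of A' B'] by simp
  have "card (?f -` {c}) = card (?f' -` {c})" for c
  proof -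
    obtain a b where c: "c = (a, b)" by force
    have "(\<lambda>x. (x \<in> X, x \<in> Y)) -` {(a, b)} = (if a then (if b then X \<inter> Y else X - (X \<inter> Y))
        else (if b then Y - (X \<inter> Y) else UNIV - (X \<union> Y)))" for X Y :: "'n set"
      by auto
    then show ?thesis
      using assms int by (auto simp only: c card_Diff_subset finite split: if_splits)
        (simp_all add: card_Diff_subset)
  qed
  then have "image_mset ?f (mset_set UNIV) = image_mset ?f' (mset_set UNIV)"
    by (intro multiset_eqI) (simp add: count_image_mset)
  then obtain \<sigma> where \<sigma>: "\<sigma> permutes UNIV" "\<And>x. ?f x = ?f' (\<sigma> x)"
    using image_mset_eq_implies_permutes[of UNIV ?f ?f'] by auto
  have "\<sigma> ` X = Y" if "\<And>x. x \<in> X \<longleftrightarrow> \<sigma> x \<in> Y" for X Y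
  proof -
    have "\<sigma> ` X \<subseteq> Y" using that by auto
    moreover have "y \<in> \<sigma> ` X" if "y \<in> Y" for y
      using permutes_surj[OF \<sigma>(1)] that \<open>\<And>x. x \<in> X \<longleftrightarrow> \<sigma> x \<in> Y\<close> by (metis imageI surjD)
    ultimately show ?thesis by auto
  qed
  with \<sigma> show thesis by (intro that[of \<sigma>]) auto
qed

section \<open>The commutant\<close>

lemma linear_act: "linear (act \<sigma>)"
  by (rule linearI) (simp_all add: act_add act_scaleR)

lemma Com_kernel_invariant:
  fixes k :: "'n::finite set \<Rightarrow> 'n set \<Rightarrow> real"
  assumes "kernel_op k \<in> Com" "\<sigma> permutes UNIV"
  shows "k (\<sigma> ` A) (\<sigma> ` B) = k A B"
proof -
  have bij: "bij ((`) \<sigma> :: 'n set \<Rightarrow> _)"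
    using assms(2) by (metis bij_betw_Pow Pow_UNIV permutes_bij)
  have "(\<Sum>B\<in>UNIV. k (\<sigma> ` A) (\<sigma> ` B) *\<^sub>R pbasis (\<sigma> ` B)) = kernel_op k (act \<sigma> (pbasis A))"
    using sum.reindex_bij_betw[OF bij, of "\<lambda>B. k (\<sigma> ` A) B *\<^sub>R pbasis B"]
    by (simp add: act_pbasis[OF assms(2)] kernel_op_pbasis)
  also have "\<dots> = act \<sigma> (kernel_op k (pbasis A))"
    using assms by (auto simp: Com_def fun_eq_iff)
  also have "\<dots> = (\<Sum>B\<in>UNIV. k A B *\<^sub>R pbasis (\<sigma> ` B))"
    by (simp add: kernel_op_pbasis linear_sum[OF linear_act] act_scaleR act_pbasis[OF assms(2)])
  finally have "(\<Sum>B\<in>UNIV. k (\<sigma> ` A) (\<sigma> ` B) *\<^sub>R pbasis (\<sigma> ` B)) = \<dots>" .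
  then have "(\<Sum>C\<in>UNIV. k (\<sigma> ` A) C *\<^sub>R pbasis C) =
      (\<Sum>C\<in>UNIV. k A (inv \<sigma> ` C) *\<^sub>R pbasis C)"
    using sum.reindex_bij_betw[OF bij, of "\<lambda>C. k (\<sigma> ` A) C *\<^sub>R pbasis C"]
      sum.reindex_bij_betw[OF bij, of "\<lambda>C. k A (inv \<sigma> ` C) *\<^sub>R pbasis C"]
    by (simp add: image_inv_f_f permutes_inj[OF assms(2)])
  from pbasis_coeffs_unique[OF this, of "\<sigma> ` B"] show ?thesis
    by (simp add: image_inv_f_f permutes_inj[OF assms(2)])
qed

lemma Com_subset_generated:
  "(Com :: ('n::finite idem_ring \<Rightarrow> _) set) \<subseteq> generated_algebra {derivation, complementation}"
proof
  fix h :: "'n idem_ring \<Rightarrow> 'n idem_ring"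
  assume h: "h \<in> Com"
  then have "linear h" by (simp add: Com_def)
  then obtain k where k: "h = kernel_op k" by (rule ex_kernel)
  have inv: "k A B = k A' B'"
    if "card A = card A'" "card B = card B'" "card (A \<union> B) = card (A' \<union> B')" for A B A' B'
  proof -
    from that obtain \<sigma> where "\<sigma> permutes UNIV" "\<sigma> ` A = A'" "\<sigma> ` B = B'"
      by (rule pair_transport)
    with h k show ?thesis using Com_kernel_invariant[of k \<sigma> A B] by simp
  qed
  let ?type = "\<lambda>A B :: 'n set. (card A, card B, card (A \<union> B))"
  let ?orbit = "\<lambda>(i, j, u). orbit_kernel i j u :: 'n set \<Rightarrow> 'n set \<Rightarrow> real"
  let ?n = "CARD('n)"
  let ?T = "{..?n} \<times> {..?n} \<times> {..?n}"
  have "\<exists>x. \<forall>A B. ?type A B = t \<longrightarrow> k A B = x" for t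
    using inv by (metis prod.inject)
  then obtain \<kappa> where \<kappa>: "\<And>A B. k A B = \<kappa> (?type A B)"
    by metis
  have "k A B = (\<Sum>t\<in>?T. \<kappa> t * ?orbit t A B)" for A B
  proof -
    have "(\<Sum>t\<in>?T. \<kappa> t * ?orbit t A B) = (\<Sum>t\<in>?T. if t = ?type A B then \<kappa> t else 0)"
      by (intro sum.cong) (auto simp: orbit_kernel_def)
    moreover have "?type A B \<in> ?T"
      by (auto intro: card_mono)
    ultimately show ?thesis by (simp add: \<kappa>)
  qed
  then have "k = (\<lambda>A B. \<Sum>t\<in>?T. \<kappa> t * ?orbit t A B)"
    by blast
  also have "\<dots> \<in> generated_kernels"
  proof (intro generated_kernels_sum generated_kernels_scale)
    show "?orbit t \<in> generated_kernels" for t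
      by (cases t) (simp add: orbit_kernel_generated)
  qed
  finally show "h \<in> generated_algebra {derivation, complementation}"
    by (simp add: generated_kernels_def k)
qed

lemma derivation_Com: "derivation \<in> Com"
proof -
  have "derivation \<circ> act \<sigma> = act \<sigma> \<circ> derivation" if \<sigma>: "\<sigma> permutes UNIV" for \<sigma> :: "'n::finite \<Rightarrow> 'n"
  proof (rule linear_eqI_pbasis)
    fix A :: "'n set"
    have inj: "inj \<sigma>" using \<sigma> by (rule permutes_inj)
    then have "\<sigma> ` A - {\<sigma> i} = \<sigma> ` (A - {i})" for i
      by (simp add: image_set_diff)
    then show "(derivation \<circ> act \<sigma>) (pbasis A) = (act \<sigma> \<circ> derivation) (pbasis A)"
      using inj
      by (simp add: act_pbasis[OF \<sigma>] derivation_pbasis linear_sum[OF linear_act]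
          sum.reindex inj_on_subset)
  qed (simp_all add: linear_compose linear_act linear_derivation)
  then show ?thesis unfolding Com_def using linear_derivation by blast
qed

lemma complementation_Com: "complementation \<in> Com"
proof -
  have "complementation \<circ> act \<sigma> = act \<sigma> \<circ> complementation" if \<sigma>: "\<sigma> permutes UNIV"
    for \<sigma> :: "'n::finite \<Rightarrow> 'n"
    by (rule linear_eqI_pbasis)
      (simp_all add: linear_compose linear_act linear_complementation act_pbasis[OF \<sigma>]
        complementation_pbasis image_set_diff[OF permutes_inj[OF \<sigma>]]
        permutes_surj[OF \<sigma>])
  then show ?thesis unfolding Com_def using linear_complementation by blast
qed

lemma generated_subset_Com: "generated_algebra {derivation, complementation} \<subseteq> Com"
proof
  fix f :: "'n::finite idem_ring \<Rightarrow> 'n idem_ring"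
  assume "f \<in> generated_algebra {derivation, complementation}"
  then show "f \<in> Com"
  proof induction
    case (gen g)
    then show ?case using derivation_Com complementation_Com by auto
  next
    case zero
    show ?case by (auto simp: Com_def fun_eq_iff linear_0[OF linear_act] module_hom_zero)
  next
    case (add f g)
    then show ?case by (auto simp: Com_def fun_eq_iff act_add intro: linear_compose_add)
  next
    case (scaleR f c)
    then show ?case
      by (auto simp: Com_def fun_eq_iff act_scaleR intro: linear_compose_scale_right)
  next
    case (comp f g)
    then show ?case by (auto simp: Com_def fun_eq_iff intro: linear_compose[unfolded comp_def])
  qed
qed

theorem theorem5:
  shows "(Com :: ('n::finite idem_ring \<Rightarrow> 'n idem_ring) set) =
    generated_algebra {derivation, complementation}"
  using Com_subset_generated generated_subset_Com by (rule subset_antisym)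

end
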